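(* Let $(\mathbf H,\mathbf z,\mathcal G)$ be a network linear equation as in the context, and assume: (A1) $\operatorname{rank}(\mathbf H)=m$ and $\mathbf z\in\operatorname{span}(\mathbf H)$, so that $\mathbf z=\mathbf H\mathbf y$ has a unique solution $\mathbf y^*$; (A2) $\max_i\|\mathbf x_i(0)\|_\infty\le C_x$ and $\max_i\|\mathbf x_i(0)-\mathbf y^*\|_\infty\le C_w$ for some positive constants $C_x,C_w$; (A3) $\gamma(k)\equiv 1$ and $s(k)=s(0)\alpha^k$ for all $k\ge0$, for some $s(0)>0$ and $\alpha\in(0,1)$. For an integer $K\ge1$ let $$\Xi_K=\left\{(\alpha,h):\ h\in\left(0,\tfrac{2}{\lambda_{\min}(\mathbf F_d)+\lambda_{\max}(\mathbf F_d)}\right),\ \alpha\in(1-h\lambda_{\min}(\mathbf F_d),1),\ M(\alpha,h)<K+\tfrac12\right\}.$$ Then: (i) For any integer $K\ge1$, $\Xi_K$ is nonempty. (ii) For any integer $K\ge1$, let $(\alpha,h)\in\Xi_K$ and let $s(0)$ satisfy $$s(0)>\max\left\{\frac{C_x+h\|\mathbf H_d\|_\infty C_w}{K+\frac12},\ \frac{2(\alpha-\rho_h)\left(\rho_hC_w+hC_x\lambda_N(\mathbf L)\right)}{h\lambda_N(\mathbf L)}\right\}.$$ Then the sequences generated by the distributed quantized algorithm (with parameters $h,K,s(\cdot),\gamma(\cdot)$) satisfy $\lim_{k\to\infty}\mathbf x_i(k)=\mathbf y^*$ for all $i\in\mathcal V$, and, with $\mathbf x(k)=(\mathbf x_1(k)^\top,\dots,\mathbf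 x_N(k)^\top)^\top$, $$\limsup_{k\to\infty}\frac{\|\mathbf x(k)-\mathbf 1_N\otimes\mathbf y^*\|_2}{\alpha^k}\le\frac{h\,s(0)\sqrt{mN}\,\lambda_N(\mathbf L)}{2\alpha(\alpha-\rho_h)}.$$
   Context: Setting. $N\ge2$, $m\ge1$; $\mathbf H\in\mathbb R^{N\times m}$ has $i$-th row $\mathbf h_i^\top$ ($\mathbf h_i\in\mathbb R^m$), $\mathbf z=(z_1,\dots,z_N)^\top\in\mathbb R^N$; $\operatorname{span}(\mathbf H)$ is the column space. $\mathcal G=(\mathcal V,\mathcal E)$ is a connected undirected simple graph on $\mathcal V=\{1,\dots,N\}$ with neighbor sets $\mathcal N_i$, maximum degree $d^*=\max_i|\mathcal N_i|$, and Laplacian $\mathbf L$ (degree matrix minus adjacency matrix) with eigenvalues $0=\lambda_1(\mathbf L)<\lambda_2(\mathbf L)\le\dots\le\lambda_N(\mathbf L)$. Norms of matrices are the induced ones; $\mathbf 1_N$ is the all-ones vector; $\otimes$ is the Kronecker product. Matrices: $\mathbf H_d=\operatorname{diag}\{\mathbf h_1\mathbf h_1^\top,\dots,\mathbf h_N\mathbf h_N^\top\}\in\mathbb R^{mN\times mN}$ (block diagonal), $\mathbf F_d=\mathbf L\otimes\mathbf I_m+\mathbf H_d$, with smallest/largest eigenvalues $\lambda_{\min}(\mathbf F_d),\lambda_{\max}(\mathbf F_d)$; $\rho_h=1-h\lambda_{\min}(\mathbf F_d)$. Define $$M(\alpha,h)=\frac{1+2hd^*}{2\alpha}+\frac{h^2\sqrt{mN}\,\lambda_N(\mathbf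 L)\lambda_{\max}(\mathbf F_d)}{2\alpha(\alpha-\rho_h)}.$$ Quantizer: for an integer $K\ge1$, $Q_K:\mathbb R\to\{-K,\dots,K\}$ is $Q_K(z)=0$ if $-\frac12\le z\le\frac12$; $Q_K(z)=i$ if $\frac{2i-1}2<z\le\frac{2i+1}2$, $i=1,\dots,K$; $Q_K(z)=K$ if $z>\frac{2K+1}2$; $Q_K(z)=-Q_K(-z)$ if $z<-\frac12$. It is applied componentwise to vectors. Distributed quantized algorithm: given initial states $\mathbf x_i(0)\in\mathbb R^m$, a step $h>0$, a sequence $\gamma(k)$ and a positive scaling sequence $s(k)$: encoder at node $j$: $\mathbf b_j(0)=0$ and, for $k\ge1$, $\mathbf q_j(k)=Q_K\left(\frac{1}{s(k-1)}(\mathbf x_j(k)-\mathbf b_j(k-1))\right)$, $\mathbf b_j(k)=s(k-1)\mathbf q_j(k)+\mathbf b_j(k-1)$; decoder at node $i\in\mathcal N_j$: $\hat{\mathbf x}_{ij}(0)=0$ and, for $k\ge1$, $\hat{\mathbf x}_{ij}(k)=s(k-1)\mathbf q_j(k)+\hat{\mathbf x}_{ij}(k-1)$; update, $k\ge0$: $\mathbf x_i(k+1)=\mathbf x_i(k)+h\left[\sum_{j\in\mathcal N_i}(\hat{\mathbf x}_{ij}(k)-\mathbf b_i(k))-\gamma(k)(\mathbf h_i\mathbf h_i^\top\mathbf x_i(k)-z_i\mathbf h_i)\right]$. *)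

theory Defs
  imports "HOL-Analysis.Analysis"
begin

section \<open>Matrices indexed by finite types\<close>

text \<open>
  The number of nodes is \<^term>\<open>CARD('n)\<close> and the number of unknowns is \<^term>\<open>CARD('m)\<close>. Matrices of size
  \<open>mN \<times> mN\<close> and vectors of length \<open>mN\<close> are indexed by the product type \<^typ>\<open>'n \<times> 'm\<close>: the entry
  \<open>(i, c)\<close> is component \<open>c\<close> of the block belonging to node \<open>i\<close>.
\<close>

definition eigenvalues :: "real^'k^'k \<Rightarrow> real set" where
  "eigenvalues A = {l. \<exists>v. v \<noteq> 0 \<and> A *v v = l *\<^sub>R v}"

text \<open>Only meant for symmetric matrices, whose eigenvalues are all real; otherwise the set of
  real eigenvalues may be empty and \<^const>\<open>Min\<close> and \<^const>\<open>Max\<close> are unspecified.\<close>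

definition lambda_min :: "real^'k^'k \<Rightarrow> real" where
  "lambda_min A = Min (eigenvalues A)"

definition lambda_max :: "real^'k^'k \<Rightarrow> real" where
  "lambda_max A = Max (eigenvalues A)"

text \<open>Matrix norm induced by the maximum norm on vectors, in the style of \<^const>\<open>onorm\<close>; the
  quotient is \<open>0\<close> at \<open>x = 0\<close>.\<close>

definition inf_matrix_norm :: "real^'k^'l \<Rightarrow> real" where
  "inf_matrix_norm A = (SUP x. infnorm (A *v x) / infnorm x)"

definition outer :: "real^'k \<Rightarrow> real^'k^'k" where
  "outer v = (\<chi> a b. v $ a * v $ b)"

definition kron :: "real^'j^'i \<Rightarrow> real^'l^'k \<Rightarrow> real^('j \<times> 'l)^('i \<times> 'k)" where
  "kron A B = (\<chi> p r. A $ fst p $ fst r * B $ snd p $ snd r)"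

definition kron_vec :: "real^'i \<Rightarrow> real^'k \<Rightarrow> real^('i \<times> 'k)" where
  "kron_vec u v = (\<chi> p. u $ fst p * v $ snd p)"

definition block_diag :: "('n::finite \<Rightarrow> real^'m^'m) \<Rightarrow> real^('n \<times> 'm)^('n \<times> 'm)" where
  "block_diag B = (\<chi> p r. if fst p = fst r then B (fst p) $ snd p $ snd r else 0)"

definition stack :: "('n::finite \<Rightarrow> real^'m) \<Rightarrow> real^('n \<times> 'm)" where
  "stack x = (\<chi> p. x (fst p) $ snd p)"


section \<open>Graphs\<close>

text \<open>A simple undirected graph on the vertex set \<^term>\<open>UNIV :: 'n set\<close> is given by a symmetric
  irreflexive adjacency relation \<open>E\<close>.\<close>

definition nbrs :: "('n \<times> 'n) set \<Rightarrow> 'n \<Rightarrow> 'n set" where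
  "nbrs E i = {j. (i, j) \<in> E}"

definition max_degree :: "('n::finite \<times> 'n) set \<Rightarrow> nat" where
  "max_degree E = Max (range (\<lambda>i. card (nbrs E i)))"

definition laplacian :: "('n::finite \<times> 'n) set \<Rightarrow> real^'n^'n" where
  "laplacian E =
     (\<chi> i j. if i = j then real (card (nbrs E i)) else 0) - (\<chi> i j. if (i, j) \<in> E then 1 else 0)"


section \<open>Network linear equations\<close>

definition H_d :: "real^'m^'n \<Rightarrow> real^('n \<times> 'm)^('n \<times> 'm)" where
  "H_d H = block_diag (\<lambda>i. outer (H $ i))"

definition F_d :: "('n \<times> 'n) set \<Rightarrow> real^'m^'n \<Rightarrow> real^('n \<times> 'm)^('n \<times> 'm)" where
  "F_d E H = kron (laplacian E) (mat 1) + H_d H"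

definition rho :: "('n \<times> 'n) set \<Rightarrow> real^'m^'n \<Rightarrow> real \<Rightarrow> real" where
  "rho E H h = 1 - h * lambda_min (F_d E H)"

definition M :: "('n \<times> 'n) set \<Rightarrow> real^'m^'n \<Rightarrow> real \<Rightarrow> real \<Rightarrow> real" where
  "M E H \<alpha> h =
     (1 + 2 * h * real (max_degree E)) / (2 * \<alpha>)
     + h\<^sup>2 * sqrt (real (CARD('m) * CARD('n))) * lambda_max (laplacian E) * lambda_max (F_d E H)
       / (2 * \<alpha> * (\<alpha> - rho E H h))"

definition Xi :: "('n \<times> 'n) set \<Rightarrow> real^'m^'n \<Rightarrow> int \<Rightarrow> (real \<times> real) set" where
  "Xi E H K = {(\<alpha>, h).
     h \<in> {0 <..< 2 / (lambda_min (F_d E H) + lambda_max (F_d E H))} \<and>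
     \<alpha> \<in> {1 - h * lambda_min (F_d E H) <..< 1} \<and>
     M E H \<alpha> h < of_int K + 1/2}"


section \<open>Distributed quantized algorithm\<close>

definition quantizer_pos :: "int \<Rightarrow> real \<Rightarrow> int" where
  "quantizer_pos K z =
     (if z \<le> 1/2 then 0
      else if z > (2 * of_int K + 1) / 2 then K
      else (THE i. i \<in> {1..K} \<and> (2 * of_int i - 1) / 2 < z \<and> z \<le> (2 * of_int i + 1) / 2))"

definition quantizer :: "int \<Rightarrow> real \<Rightarrow> int" where
  "quantizer K z = (if z < - 1/2 then - quantizer_pos K (- z) else quantizer_pos K z)"

definition quantize :: "int \<Rightarrow> real^'m \<Rightarrow> real^'m" where
  "quantize K v = (\<chi> c. of_int (quantizer K (v $ c)))"

text \<open>
  The sequences \<open>x\<close>, \<open>b\<close>, \<open>q\<close>, \<open>xhat\<close> are produced by the algorithm from the initial states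
  \<open>x0\<close>. The time index comes first; \<open>xhat k i j\<close> is the estimate of the state of node \<open>j\<close> decoded at
  its neighbor \<open>i\<close>. The values \<open>q 0 j\<close>, and \<open>xhat k i j\<close> for non-adjacent \<open>i\<close>, \<open>j\<close>, are never used
  and remain unconstrained.
\<close>

definition quantized_algorithm ::
  "('n::finite \<times> 'n) set \<Rightarrow> real^'m^'n \<Rightarrow> real^'n \<Rightarrow> ('n \<Rightarrow> real^'m) \<Rightarrow>
   real \<Rightarrow> int \<Rightarrow> (nat \<Rightarrow> real) \<Rightarrow> (nat \<Rightarrow> real) \<Rightarrow>
   (nat \<Rightarrow> 'n \<Rightarrow> real^'m) \<Rightarrow> (nat \<Rightarrow> 'n \<Rightarrow> real^'m) \<Rightarrow> (nat \<Rightarrow> 'n \<Rightarrow> real^'m) \<Rightarrow>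
   (nat \<Rightarrow> 'n \<Rightarrow> 'n \<Rightarrow> real^'m) \<Rightarrow> bool" where
  "quantized_algorithm E H z x0 h K s \<gamma> x b q xhat \<longleftrightarrow>
     (\<forall>i. x 0 i = x0 i) \<and>
     (\<forall>j. b 0 j = 0) \<and>
     (\<forall>k j. q (Suc k) j = quantize K ((1 / s k) *\<^sub>R (x (Suc k) j - b k j))) \<and>
     (\<forall>k j. b (Suc k) j = s k *\<^sub>R q (Suc k) j + b k j) \<and>
     (\<forall>j. \<forall>i \<in> nbrs E j. xhat 0 i j = 0) \<and>
     (\<forall>k j. \<forall>i \<in> nbrs E j. xhat (Suc k) i j = s k *\<^sub>R q (Suc k) j + xhat k i j) \<and>
     (\<forall>k i. x (Suc k) i = x k i + h *\<^sub>R
        ((\<Sum>j \<in> nbrs E i. xhat k i j - b k i)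
         - \<gamma> k *\<^sub>R (outer (H $ i) *v x k i - z $ i *\<^sub>R H $ i)))"

end

theory Submission
  imports Defs
begin

text \<open>
  With the tracking error \<open>w = x - 1 \<otimes> y*\<close> and the quantisation error \<open>e = x - b\<close> the algorithm reads
  \<open>w(k+1) = (I - h F) w(k) + h (L \<otimes> I) e(k)\<close>, where \<open>F\<close> is positive definite and \<open>I - h F\<close> is a
  contraction with factor \<open>\<rho>\<close>. As long as the quantiser does not saturate, \<open>e(k+1)\<close> is at most
  \<open>s(k) / 2\<close> in the maximum norm, so that \<open>w(k) / s(k)\<close> stays bounded; conversely the quantiser input
  \<open>(I + h (L \<otimes> I)) e(k) - h F w(k)\<close> is then small enough, because \<open>M(\<alpha>, h) < K + 1/2\<close>, to exclude
  saturation in the next step. Nonemptiness of \<open>\<Xi>\<close> follows from \<open>M(\<alpha>, h) \<rightarrow> 1/2\<close> as \<open>h \<rightarrow> 0\<close> with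
  \<open>\<alpha>\<close> halfway between \<open>\<rho>\<close> and \<open>1\<close>.
\<close>

section \<open>Extremal eigenvalues of symmetric matrices\<close>

lemma inner_symmetric_matrix:
  fixes A :: "real^'k^'k"
  assumes "transpose A = A"
  shows "u \<bullet> (A *v v) = (A *v u) \<bullet> v"
  by (metis assms dot_lmul_matrix transpose_matrix_vector)

text \<open>The form vanishes at \<open>u\<close>. If \<open>A *v u\<close> were nonzero, its
  derivative along \<open>A *v u\<close> would be nonzero too, and the form would become negative on
  one side of \<open>u\<close>.\<close>

lemma psd_kernel:
  fixes A :: "real^'k^'k"
  assumes A: "transpose A = A" and psd: "\<And>v. 0 \<le> v \<bullet> (A *v v)" and u: "u \<bullet> (A *v u) = 0"
  shows "A *v u = 0"
proof (rule ccontr)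
  define w where "w = A *v u"
  define p where "p = w \<bullet> w"
  define q where "q = w \<bullet> (A *v w)"
  assume "A *v u \<noteq> 0"
  then have p: "p > 0" by (simp add: p_def w_def)
  have q: "q \<ge> 0" using psd by (simp add: q_def)
  \<comment> \<open>The minimiser \<open>- p / q\<close> fails for \<open>q = 0\<close>; enlarging
    the denominator to \<open>1 + q\<close> avoids this and still makes the form negative.\<close>
  define t where "t = - p / (1 + q)"
  have "u \<bullet> (A *v w) = p"
    using inner_symmetric_matrix[OF A] by (simp add: p_def w_def)
  then have "(u + t *\<^sub>R w) \<bullet> (A *v (u + t *\<^sub>R w)) = 2 * t * p + t * t * q"
    using u by (simp add: matrix_vector_right_distrib matrix_vector_mult_scaleR inner_add_left
        inner_add_right p_def q_def w_def[symmetric] algebra_simps)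
  with psd[of "u + t *\<^sub>R w"] have "0 \<le> 2 * t * p + t * t * q" by simp
  also have "\<dots> = - (p * p) * (2 + q) / ((1 + q) * (1 + q))"
    using q by (simp add: t_def divide_simps) (simp add: algebra_simps)
  also have "\<dots> < 0"
    using p q by (intro divide_neg_pos mult_neg_pos) auto
  finally show False by simp
qed

text \<open>The maximum \<open>\<mu>\<close> of the Rayleigh quotient is attained on the unit sphere, at a vector in the
  kernel of the positive semidefinite matrix \<open>\<mu> I - A\<close>.\<close>

lemma ex_eigenvalue_rayleigh_upper:
  fixes A :: "real^'k^'k"
  assumes A: "transpose A = A"
  shows "\<exists>\<mu>\<in>eigenvalues A. \<forall>v. v \<bullet> (A *v v) \<le> \<mu> * (v \<bullet> v)"
proof -
  let ?f = "\<lambda>v. v \<bullet> (A *v v)"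
  have "continuous_on (sphere 0 1) ?f"
    by (intro continuous_intros matrix_vector_mult_linear_continuous_on)
  then obtain u where u: "u \<in> sphere 0 1" and mx: "\<And>v. v \<in> sphere 0 1 \<Longrightarrow> ?f v \<le> ?f u"
    using continuous_attains_sup[of "sphere 0 1 :: (real^'k) set" ?f] by auto
  define \<mu> where "\<mu> = ?f u"
  have le: "?f v \<le> \<mu> * (v \<bullet> v)" for v
  proof (cases "v = 0")
    case False
    have "?f ((1 / norm v) *\<^sub>R v) \<le> \<mu>"
      unfolding \<mu>_def using False by (intro mx) simp
    then have "?f v / (norm v)\<^sup>2 \<le> \<mu>"
      by (simp add: matrix_vector_mult_scaleR power2_eq_square divide_simps)
    with False show ?thesis by (simp add: divide_simps power2_norm_eq_inner)
  qed simp
  define B where "B = \<mu> *\<^sub>R mat 1 - A"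
  have B: "B *v v = \<mu> *\<^sub>R v - A *v v" for v
    by (simp add: B_def matrix_vector_mult_diff_rdistrib scaleR_matrix_vector_assoc[symmetric])
  have "transpose B = B"
    using A by (simp add: B_def transpose_def mat_def vec_eq_iff)
  moreover have "0 \<le> v \<bullet> (B *v v)" for v
    using le[of v] by (simp add: B inner_diff_right)
  moreover have "u \<bullet> u = 1"
    using u by (simp add: norm_eq_1)
  then have "u \<bullet> (B *v u) = 0"
    by (simp add: B inner_diff_right \<mu>_def)
  ultimately have "B *v u = 0"
    by (rule psd_kernel)
  then have "\<mu> \<in> eigenvalues A"
    using u by (auto simp: eigenvalues_def B intro!: exI[of _ u])
  with le show ?thesis by blast
qed

lemma transpose_uminus: "transpose (- A) = - transpose (A :: real^'k^'l)"
  by (simp add: transpose_def vec_eq_iff)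

text \<open>Apply the upper bound to \<open>- A\<close>, whose eigenvalues are those of
  \<open>A\<close> with the sign changed.\<close>

lemma ex_eigenvalue_rayleigh_lower:
  fixes A :: "real^'k^'k"
  assumes A: "transpose A = A"
  shows "\<exists>\<mu>\<in>eigenvalues A. \<forall>v. \<mu> * (v \<bullet> v) \<le> v \<bullet> (A *v v)"
proof -
  have neg: "(- A) *v v = - (A *v v)" for v
    by (metis add.right_inverse add_eq_0_iff matrix_vector_mult_0 matrix_vector_mult_add_rdistrib)
  from A have "transpose (- A) = - A" by (simp add: transpose_uminus)
  from ex_eigenvalue_rayleigh_upper[OF this] obtain \<mu> where
    \<mu>: "\<mu> \<in> eigenvalues (- A)" and le: "\<And>v. v \<bullet> ((- A) *v v) \<le> \<mu> * (v \<bullet> v)" by blast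
  from \<mu> have "- \<mu> \<in> eigenvalues A"
    by (simp add: eigenvalues_def neg) (metis minus_minus)
  moreover have "- \<mu> * (v \<bullet> v) \<le> v \<bullet> (A *v v)" for v
    using le[of v] by (simp add: neg)
  ultimately show ?thesis by blast
qed

text \<open>Eigenvectors of a symmetric matrix for different eigenvalues are orthogonal, so one
  eigenvector \<open>f l\<close> per eigenvalue gives an independent, hence finite, family.
  Finiteness is what gives \<open>Min\<close> and \<open>Max\<close> their meaning in
  \<open>lambda_min\<close> and \<open>lambda_max\<close>.\<close>

lemma finite_eigenvalues:
  fixes A :: "real^'k^'k"
  assumes A: "transpose A = A"
  shows "finite (eigenvalues A)"
proof -
  define f where "f l = (SOME v. v \<noteq> 0 \<and> A *v v = l *\<^sub>R v)" for l
  have f: "f l \<noteq> 0 \<and> A *v f l = l *\<^sub>R f l" if "l \<in> eigenvalues A" for l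
    unfolding f_def by (rule someI_ex) (use that in \<open>simp add: eigenvalues_def\<close>)
  have orth: "f l \<bullet> f l' = 0" if "l \<in> eigenvalues A" "l' \<in> eigenvalues A" "l \<noteq> l'" for l l'
  proof -
    have "l' * (f l \<bullet> f l') = l * (f l \<bullet> f l')"
      using inner_symmetric_matrix[OF A, of "f l" "f l'"] f[OF that(1)] f[OF that(2)] by simp
    with that(3) show ?thesis by simp
  qed
  \<comment> \<open>A vector chosen for two different eigenvalues would be orthogonal to itself,
    hence zero.\<close>
  have inj: "inj_on f (eigenvalues A)"
    by (rule inj_onI) (metis f inner_eq_zero_iff orth)
  have "pairwise orthogonal (f ` eigenvalues A)"
    by (auto simp: pairwise_def orthogonal_def intro: orth)
  moreover have "0 \<notin> f ` eigenvalues A"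
    using f by auto
  ultimately have "independent (f ` eigenvalues A)"
    by (rule pairwise_orthogonal_independent)
  then have "finite (f ` eigenvalues A)"
    by (rule independent_imp_finite)
  with inj show ?thesis by (simp add: finite_image_iff)
qed

text \<open>Some eigenvalue bounds the Rayleigh quotient; replacing it by the largest one only
  weakens the bound, since \<open>v \<bullet> v\<close> is nonnegative.\<close>

lemma lambda_max_upper:
  fixes A :: "real^'k^'k"
  assumes A: "transpose A = A"
  shows "v \<bullet> (A *v v) \<le> lambda_max A * (v \<bullet> v)"
proof -
  obtain \<mu> where \<mu>: "\<mu> \<in> eigenvalues A" "v \<bullet> (A *v v) \<le> \<mu> * (v \<bullet> v)"
    using ex_eigenvalue_rayleigh_upper[OF A] by blast
  moreover have "\<mu> \<le> lambda_max A"
    unfolding lambda_max_def using \<mu> finite_eigenvalues[OF A] by simp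
  ultimately show ?thesis
    by (meson inner_ge_zero mult_right_mono order_trans)
qed

lemma lambda_min_lower:
  fixes A :: "real^'k^'k"
  assumes A: "transpose A = A"
  shows "lambda_min A * (v \<bullet> v) \<le> v \<bullet> (A *v v)"
proof -
  obtain \<mu> where \<mu>: "\<mu> \<in> eigenvalues A" "\<mu> * (v \<bullet> v) \<le> v \<bullet> (A *v v)"
    using ex_eigenvalue_rayleigh_lower[OF A] by blast
  moreover have "lambda_min A \<le> \<mu>"
    unfolding lambda_min_def using \<mu> finite_eigenvalues[OF A] by simp
  ultimately show ?thesis
    by (meson inner_ge_zero mult_right_mono order_trans)
qed

lemma lambda_min_pos:
  fixes A :: "real^'k^'k"
  assumes A: "transpose A = A" and pd: "\<And>v. v \<noteq> 0 \<Longrightarrow> 0 < v \<bullet> (A *v v)"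
  shows "0 < lambda_min A"
proof -
  have "eigenvalues A \<noteq> {}" using ex_eigenvalue_rayleigh_lower[OF A] by blast
  then have "lambda_min A \<in> eigenvalues A"
    unfolding lambda_min_def using finite_eigenvalues[OF A] by (rule Min_in[rotated])
  then obtain v where v: "v \<noteq> 0" "A *v v = lambda_min A *\<^sub>R v"
    by (auto simp: eigenvalues_def)
  with pd[of v] have "0 < lambda_min A * (v \<bullet> v)" by simp
  with v show ?thesis by (metis inner_gt_zero_iff zero_less_mult_pos2)
qed

lemma lambda_min_le_lambda_max:
  fixes A :: "real^'k^'k"
  assumes A: "transpose A = A"
  shows "lambda_min A \<le> lambda_max A"
proof -
  have "eigenvalues A \<noteq> {}" using ex_eigenvalue_rayleigh_lower[OF A] by blast
  with finite_eigenvalues[OF A] show ?thesis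
    by (simp add: lambda_min_def lambda_max_def Min_le_iff)
qed

text \<open>By polarisation, the quadratic form controls the bilinear form.\<close>

lemma norm_symmetric_matrix_le:
  fixes A :: "real^'k^'k"
  assumes A: "transpose A = A" and le: "\<And>v. \<bar>v \<bullet> (A *v v)\<bar> \<le> c * (v \<bullet> v)"
  shows "norm (A *v v) \<le> c * norm v"
proof (cases "A *v v = 0 \<or> v = 0")
  case True
  have "0 \<le> c * (axis undefined 1 \<bullet> (axis undefined 1 :: real^'k))"
    using le by (meson abs_ge_zero order_trans)
  then have "0 \<le> c" by (simp add: inner_axis_axis)
  with True show ?thesis by auto
next
  case False
  \<comment> \<open>The factor \<open>a\<close> gives \<open>u\<close> the direction of
    \<open>A *v v\<close> and the length of \<open>v\<close>. Then
    \<open>u \<bullet> (A *v v)\<close> is the product of the norms, and the parallelogram law turns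
    the polarised bound into \<open>4 * (c * (v \<bullet> v))\<close>.\<close>
  define a where "a = norm v / norm (A *v v)"
  define u where "u = a *\<^sub>R (A *v v)"
  have nu: "u \<bullet> u = v \<bullet> v"
    using False by (simp add: u_def a_def power2_norm_eq_inner[symmetric] dot_square_norm)
  have "4 * (u \<bullet> (A *v v)) = (u + v) \<bullet> (A *v (u + v)) - (u - v) \<bullet> (A *v (u - v))"
    using inner_symmetric_matrix[OF A, of u v]
    by (simp add: matrix_vector_right_distrib matrix_vector_mult_diff_distrib
        inner_add_left inner_add_right inner_diff_left inner_diff_right inner_commute)
  also have "\<dots> \<le> c * ((u + v) \<bullet> (u + v)) + c * ((u - v) \<bullet> (u - v))"
    using le[of "u + v"] le[of "u - v"] by linarith
  also have "\<dots> = 4 * (c * (v \<bullet> v))"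
    by (simp add: inner_add_left inner_add_right inner_diff_left inner_diff_right nu
        inner_commute algebra_simps)
  finally have "u \<bullet> (A *v v) \<le> c * (v \<bullet> v)" by simp
  moreover have "u \<bullet> (A *v v) = norm v * norm (A *v v)"
    using False by (simp add: u_def a_def dot_square_norm power2_eq_square)
  ultimately have "norm v * norm (A *v v) \<le> norm v * (c * norm v)"
    by (simp add: dot_square_norm power2_eq_square algebra_simps)
  with False show ?thesis by simp
qed

section \<open>Maximum norm and its induced matrix norm\<close>

lemma infnorm_le_cart:
  fixes v :: "real^'k"
  assumes "\<And>i. \<bar>v $ i\<bar> \<le> c"
  shows "infnorm v \<le> c"
  using assms by (auto simp: infnorm_cart intro!: cSup_least)

lemma norm_le_sqrt_card_infnorm: "norm v \<le> sqrt (real CARD('k)) * infnorm (v :: real^'k)"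
  using norm_le_infnorm[of v] by simp

lemma infnorm_matrix_vector_le:
  fixes A :: "real^'k^'l"
  shows "infnorm (A *v v) \<le> inf_matrix_norm A * infnorm v"
proof (cases "v = 0")
  case False
  \<comment> \<open>The supremum dominates each quotient only if the quotients are bounded;
    comparing the maximum norm with the Euclidean norm yields the bound \<open>c\<close>.\<close>
  define c where "c = onorm ((*v) A) * sqrt (real CARD('k))"
  have "infnorm (A *v x) / infnorm x \<le> c" for x
  proof (cases "x = 0")
    case False
    have "infnorm (A *v x) \<le> norm (A *v x)" by (rule infnorm_le_norm)
    also have "\<dots> \<le> onorm ((*v) A) * norm x"
      by (rule onorm) simp
    also have "\<dots> \<le> onorm ((*v) A) * (sqrt (real CARD('k)) * infnorm x)"
      by (intro mult_left_mono norm_le_sqrt_card_infnorm onorm_pos_le) simp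
    finally show ?thesis
      using False infnorm_pos_lt[of x] by (simp add: c_def divide_simps)
  qed (simp add: c_def onorm_pos_le infnorm_0)
  then have "bdd_above (range (\<lambda>x. infnorm (A *v x) / infnorm x))"
    by (rule bdd_aboveI2)
  then have "infnorm (A *v v) / infnorm v \<le> inf_matrix_norm A"
    unfolding inf_matrix_norm_def by (rule cSUP_upper[OF UNIV_I])
  with False show ?thesis by (simp add: divide_simps infnorm_pos_lt)
qed (simp add: infnorm_0)

lemma inf_matrix_norm_nonneg: "0 \<le> inf_matrix_norm (A :: real^'k^'l)"
proof -
  have "0 \<le> inf_matrix_norm A * infnorm (axis undefined 1 :: real^'k)"
    using infnorm_pos_le infnorm_matrix_vector_le by (rule order_trans)
  moreover have "0 < infnorm (axis undefined 1 :: real^'k)"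
    by (simp add: infnorm_pos_lt axis_eq_0_iff)
  ultimately show ?thesis
    by (meson mult_neg_pos not_le)
qed

section \<open>Rounding error of the unsaturated quantizer\<close>

text \<open>The range of \<open>u\<close> reaches down to \<open>- 1/2\<close> because
  \<open>quantizer\<close> resorts to \<open>quantizer_pos\<close> there as well.\<close>

lemma quantizer_pos_error:
  assumes "1 \<le> K" "0 \<le> u + 1/2" "u \<le> of_int K + 1/2"
  shows "\<bar>u - of_int (quantizer_pos K u)\<bar> \<le> 1/2"
proof (cases "u \<le> 1/2")
  case False
  \<comment> \<open>The cells are open on the left and closed on the right, so their index is a
    ceiling, which also yields the uniqueness that \<open>THE\<close> demands.\<close>
  define i where "i = \<lceil>u - 1/2\<rceil>"
  have i: "of_int i - 1 < u - 1/2" "u - 1/2 \<le> of_int i"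
    unfolding i_def using ceiling_correct[of "u - 1/2"] by auto
  have "quantizer_pos K u =
      (THE i. i \<in> {1..K} \<and> (2 * of_int i - 1) / 2 < u \<and> u \<le> (2 * of_int i + 1) / 2)"
    using False assms by (simp add: quantizer_pos_def field_simps)
  also have "\<dots> = i"
  proof (rule the_equality)
    have "1 \<le> i" "i \<le> K" using i False assms by linarith+
    then show "i \<in> {1..K} \<and> (2 * of_int i - 1) / 2 < u \<and> u \<le> (2 * of_int i + 1) / 2"
      using i by simp
  next
    fix j :: int
    assume "j \<in> {1..K} \<and> (2 * of_int j - 1) / 2 < u \<and> u \<le> (2 * of_int j + 1) / 2"
    then have "\<lceil>u - 1/2\<rceil> = j" by (intro ceiling_unique) (auto simp: field_simps)
    then show "j = i" by (simp add: i_def)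
  qed
  finally show ?thesis
    using i by (intro abs_leI) linarith+
qed (use assms in \<open>auto simp: quantizer_pos_def\<close>)

lemma quantizer_error:
  assumes "1 \<le> K" "\<bar>u\<bar> \<le> of_int K + 1/2"
  shows "\<bar>u - of_int (quantizer K u)\<bar> \<le> 1/2"
proof (cases "u < - 1/2")
  case True
  with assms have "\<bar>- u - of_int (quantizer_pos K (- u))\<bar> \<le> 1/2"
    by (intro quantizer_pos_error) auto
  moreover have "u - of_int (quantizer K u) = - (- u - of_int (quantizer_pos K (- u)))"
    using True by (simp add: quantizer_def)
  ultimately show ?thesis
    by (simp only: abs_minus_cancel)
next
  case False
  with assms quantizer_pos_error[of K u] show ?thesis
    by (simp add: quantizer_def)
qed

section \<open>Kronecker products with the identity\<close>

lemma sum_UNIV_prod: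
  fixes f :: "'i::finite \<times> 'j::finite \<Rightarrow> 'a::comm_monoid_add"
  shows "sum f UNIV = (\<Sum>i\<in>UNIV. \<Sum>j\<in>UNIV. f (i, j))"
  by (simp add: sum.cartesian_product flip: UNIV_Times_UNIV)

text \<open>Reduces later facts about \<open>kron (laplacian E) (mat 1)\<close> to facts about
  \<open>laplacian E\<close>, one coordinate \<open>c\<close> of the node states at a time.\<close>

lemma kron_mat_1_mult_vec:
  "(kron A (mat 1) *v v) $ (i, c) = (A *v (\<chi> j. v $ (j, c))) $ i"
proof -
  have "A $ i $ j * mat 1 $ c $ d * v $ (j, d) = (if c = d then A $ i $ j * v $ (j, d) else 0)"
    for j d
    by (simp add: mat_def)
  then show ?thesis
    by (simp add: matrix_vector_mult_def kron_def sum_UNIV_prod)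
qed

lemma inner_kron_mat_1:
  fixes v :: "real^('n::finite \<times> 'm::finite)"
  shows "v \<bullet> (kron A (mat 1) *v v) =
    (\<Sum>c\<in>UNIV. (\<chi> j. v $ (j, c)) \<bullet> (A *v (\<chi> j. v $ (j, c))))"
  unfolding inner_vec_def sum_UNIV_prod by (subst sum.swap) (simp add: kron_mat_1_mult_vec)

lemma inner_blocks:
  fixes v :: "real^('n::finite \<times> 'm::finite)"
  shows "v \<bullet> v = (\<Sum>c\<in>UNIV. (\<chi> j. v $ (j, c)) \<bullet> (\<chi> j. v $ (j, c)))"
  unfolding inner_vec_def sum_UNIV_prod by (subst sum.swap) simp

lemma transpose_kron_mat_1:
  "transpose A = A \<Longrightarrow> transpose (kron A (mat 1)) = kron A (mat 1)"
  by (auto simp: transpose_def kron_def mat_def vec_eq_iff)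

section \<open>Graph Laplacian\<close>

lemma laplacian_mult_vec:
  "(laplacian E *v v) $ i = (\<Sum>j\<in>nbrs E i. v $ i - v $ j)"
proof -
  have "(laplacian E *v v) $ i =
      (\<Sum>j\<in>UNIV. (if i = j then real (card (nbrs E i)) * v $ j else 0)
        - (if j \<in> nbrs E i then v $ j else 0))"
    unfolding matrix_vector_mult_def laplacian_def
    by (auto simp: nbrs_def algebra_simps intro!: sum.cong)
  also have "\<dots> = real (card (nbrs E i)) * v $ i - (\<Sum>j\<in>nbrs E i. v $ j)"
  proof -
    have "(\<Sum>j\<in>UNIV. if j \<in> nbrs E i then v $ j else 0) = (\<Sum>j\<in>nbrs E i. v $ j)"
      by (rule sum.mono_neutral_cong_right) auto
    then show ?thesis by (simp add: sum_subtractf)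
  qed
  finally show ?thesis by (simp add: sum_subtractf)
qed

lemma transpose_laplacian: "sym E \<Longrightarrow> transpose (laplacian E) = laplacian E"
  by (auto simp: transpose_def laplacian_def vec_eq_iff dest: symD)

text \<open>By symmetry of \<open>E\<close>, the sum of \<open>v $ i * (v $ i - v $ j)\<close> over
  the edges is unchanged when \<open>i\<close> and \<open>j\<close> are exchanged; averaging both
  versions completes the square.\<close>

lemma inner_laplacian:
  assumes "sym E"
  shows "v \<bullet> (laplacian E *v v) = (\<Sum>i\<in>UNIV. \<Sum>j\<in>nbrs E i. (v $ i - v $ j)\<^sup>2) / 2"
proof -
  define a where "a i j = (if (i, j) \<in> E then 1 else 0 :: real)" for i j
  have nb: "(\<Sum>j\<in>nbrs E i. f j) = (\<Sum>j\<in>UNIV. a i j * f j)" for i and f :: "_ \<Rightarrow> real"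
    by (rule sum.mono_neutral_cong_left) (auto simp: a_def nbrs_def)
  have *: "v \<bullet> (laplacian E *v v) = (\<Sum>i\<in>UNIV. \<Sum>j\<in>UNIV. a i j * (v $ i * (v $ i - v $ j)))"
    by (simp add: inner_vec_def laplacian_mult_vec nb sum_distrib_left mult.left_commute)
  also have "\<dots> = (\<Sum>i\<in>UNIV. \<Sum>j\<in>UNIV. a j i * (v $ j * (v $ j - v $ i)))"
    by (rule sum.swap)
  also have "\<dots> = (\<Sum>i\<in>UNIV. \<Sum>j\<in>UNIV. a i j * (v $ j * (v $ j - v $ i)))"
    using assms by (auto simp: a_def dest: symD intro!: sum.cong)
  finally have "2 * (v \<bullet> (laplacian E *v v)) =
      (\<Sum>i\<in>UNIV. \<Sum>j\<in>UNIV. a i j * (v $ i * (v $ i - v $ j)) + a i j * (v $ j * (v $ j - v $ i)))"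
    using * by (simp add: sum.distrib)
  also have "\<dots> = (\<Sum>i\<in>UNIV. \<Sum>j\<in>UNIV. a i j * (v $ i - v $ j)\<^sup>2)"
    by (intro sum.cong refl) (simp add: power2_eq_square algebra_simps)
  finally show ?thesis by (simp add: nb)
qed

lemma inner_laplacian_nonneg: "sym E \<Longrightarrow> 0 \<le> v \<bullet> (laplacian E *v v)"
  by (simp add: inner_laplacian sum_nonneg)

text \<open>A vanishing sum of squares forces equal values across each edge, and connectedness
  carries the equality along paths.\<close>

lemma laplacian_kernel:
  assumes E: "sym E" and conn: "\<And>i j. (i, j) \<in> E\<^sup>*" and 0: "v \<bullet> (laplacian E *v v) = 0"
  shows "v $ i = v $ j"
proof -
  have "(\<Sum>i\<in>UNIV. \<Sum>j\<in>nbrs E i. (v $ i - v $ j)\<^sup>2) = 0"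
    using 0 inner_laplacian[OF E, of v] by simp
  then have "\<forall>i. \<forall>j\<in>nbrs E i. (v $ i - v $ j)\<^sup>2 = 0"
    by (simp add: sum_nonneg_eq_0_iff sum_nonneg)
  then have step: "v $ i = v $ j" if "(i, j) \<in> E" for i j
    using that by (simp add: nbrs_def)
  from conn[of i j] show ?thesis
    by (induction rule: rtrancl_induct) (auto dest: step)
qed

text \<open>Needed because the lower bound on \<open>s 0\<close> divides by
  \<open>h * lambda_max (laplacian E)\<close>.\<close>

lemma lambda_max_laplacian_pos:
  fixes E :: "('n::finite \<times> 'n) set"
  assumes n: "CARD('n) \<ge> 2" and E: "sym E" and conn: "\<And>i j. (i, j) \<in> E\<^sup>*"
  shows "0 < lambda_max (laplacian E)"
proof -
  obtain i j :: 'n where "i \<noteq> j"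
    using n card_le_Suc0_iff_eq[of "UNIV :: 'n set"] by fastforce
  \<comment> \<open>With a second node present, this vector is not constant, so its quadratic form
    cannot vanish.\<close>
  define v :: "real^'n" where "v = axis i 1"
  have "v $ i \<noteq> v $ j" using \<open>i \<noteq> j\<close> by (simp add: v_def axis_def)
  then have "v \<bullet> (laplacian E *v v) \<noteq> 0"
    using laplacian_kernel[OF E conn] by blast
  with inner_laplacian_nonneg[OF E, of v] have "0 < v \<bullet> (laplacian E *v v)" by simp
  also have "\<dots> \<le> lambda_max (laplacian E) * (v \<bullet> v)"
    by (rule lambda_max_upper[OF transpose_laplacian[OF E]])
  finally show ?thesis
    by (metis inner_ge_zero linorder_not_le mult_nonpos_nonneg)
qed

section \<open>Norm bounds for the coupling matrix\<close>

text \<open>The quadratic form is a sum over \<open>c\<close> of forms of the Laplacian and so lies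
  between \<open>0\<close> and \<open>lambda_max (laplacian E) * (v \<bullet> v)\<close>; by
  symmetry this controls the norm.\<close>

lemma norm_kron_laplacian_le:
  fixes v :: "real^('n::finite \<times> 'm::finite)"
  assumes E: "sym E"
  shows "norm (kron (laplacian E) (mat 1) *v v) \<le> lambda_max (laplacian E) * norm v"
proof (rule norm_symmetric_matrix_le)
  show "transpose (kron (laplacian E) (mat 1)) = kron (laplacian E) (mat 1)"
    by (intro transpose_kron_mat_1 transpose_laplacian E)
next
  fix v :: "real^('n::finite \<times> 'm::finite)"
  have "v \<bullet> (kron (laplacian E) (mat 1) *v v) \<ge> 0"
    by (auto simp: inner_kron_mat_1 intro!: sum_nonneg inner_laplacian_nonneg E)
  moreover have "v \<bullet> (kron (laplacian E) (mat 1) *v v) \<le> lambda_max (laplacian E) * (v \<bullet> v)"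
    unfolding inner_kron_mat_1 inner_blocks sum_distrib_left
    by (intro sum_mono lambda_max_upper transpose_laplacian E)
  ultimately show "\<bar>v \<bullet> (kron (laplacian E) (mat 1) *v v)\<bar> \<le> lambda_max (laplacian E) * (v \<bullet> v)"
    by simp
qed

text \<open>Source of the numerator in the first term of \<open>M\<close>: each component collects
  at most \<open>max_degree E\<close> differences, each at most
  \<open>2 * infnorm v\<close>.\<close>

lemma infnorm_kron_laplacian_le:
  fixes v :: "real^('n::finite \<times> 'm::finite)"
  assumes "0 \<le> h"
  shows "infnorm (v + h *\<^sub>R (kron (laplacian E) (mat 1) *v v))
    \<le> (1 + 2 * h * real (max_degree E)) * infnorm v"
proof (rule infnorm_le_cart)
  fix p :: "'n \<times> 'm"
  obtain i c where p: "p = (i, c)" by (cases p)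
  have comp: "\<bar>v $ r\<bar> \<le> infnorm v" for r by (rule component_le_infnorm_cart)
  have deg: "card (nbrs E i) \<le> max_degree E"
    by (simp add: max_degree_def)
  have "\<bar>\<Sum>j\<in>nbrs E i. v $ (i, c) - v $ (j, c)\<bar> \<le> (\<Sum>j\<in>nbrs E i. 2 * infnorm v)"
  proof (rule order_trans[OF sum_abs sum_mono])
    fix j show "\<bar>v $ (i, c) - v $ (j, c)\<bar> \<le> 2 * infnorm v"
      using comp[of "(i, c)"] comp[of "(j, c)"] by linarith
  qed
  also have "\<dots> = real (card (nbrs E i)) * (2 * infnorm v)" by simp
  also have "\<dots> \<le> real (max_degree E) * (2 * infnorm v)"
    using deg by (intro mult_right_mono) (auto simp: infnorm_pos_le)
  finally have "h * \<bar>\<Sum>j\<in>nbrs E i. v $ (i, c) - v $ (j, c)\<bar>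
      \<le> h * (real (max_degree E) * (2 * infnorm v))"
    using assms by (rule mult_left_mono)
  moreover have "\<bar>(v + h *\<^sub>R (kron (laplacian E) (mat 1) *v v)) $ p\<bar>
      \<le> \<bar>v $ p\<bar> + h * \<bar>\<Sum>j\<in>nbrs E i. v $ (i, c) - v $ (j, c)\<bar>"
    using assms abs_triangle_ineq[of "v $ p"]
    by (simp add: p kron_mat_1_mult_vec laplacian_mult_vec abs_mult[symmetric]) (metis abs_mult abs_of_nonneg)
  ultimately show "\<bar>(v + h *\<^sub>R (kron (laplacian E) (mat 1) *v v)) $ p\<bar>
      \<le> (1 + 2 * h * real (max_degree E)) * infnorm v"
    using comp[of p] by (simp add: algebra_simps)
qed

section \<open>Positive definiteness of \<open>F_d\<close>\<close>

lemma H_d_mult_vec: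
  "(H_d H *v v) $ (i, c) = (H $ i \<bullet> (\<chi> d. v $ (i, d))) * H $ i $ c"
proof -
  have "(H_d H *v v) $ (i, c)
      = (\<Sum>j\<in>UNIV. \<Sum>d\<in>UNIV. if i = j then H $ i $ c * (H $ i $ d * v $ (j, d)) else 0)"
    by (auto simp: matrix_vector_mult_def H_d_def block_diag_def outer_def sum_UNIV_prod
        intro!: sum.cong)
  also have "\<dots> = (\<Sum>j\<in>UNIV. if i = j then \<Sum>d\<in>UNIV. H $ i $ c * (H $ i $ d * v $ (j, d)) else 0)"
    by (intro sum.cong) auto
  also have "\<dots> = H $ i $ c * (\<Sum>d\<in>UNIV. H $ i $ d * v $ (i, d))"
    by (simp add: sum_distrib_left)
  finally show ?thesis by (simp add: inner_vec_def)
qed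

lemma inner_H_d: "v \<bullet> (H_d H *v v) = (\<Sum>i\<in>UNIV. (H $ i \<bullet> (\<chi> d. v $ (i, d)))\<^sup>2)"
proof -
  have "v \<bullet> (H_d H *v v)
      = (\<Sum>i\<in>UNIV. \<Sum>c\<in>UNIV. (H $ i \<bullet> (\<chi> d. v $ (i, d))) * (H $ i $ c * v $ (i, c)))"
    unfolding inner_vec_def[of v] sum_UNIV_prod H_d_mult_vec by (simp add: mult_ac)
  then show ?thesis
    by (simp only: sum_distrib_left[symmetric]) (simp add: power2_eq_square inner_vec_def)
qed

lemma F_d_mult_vec: "F_d E H *v v = kron (laplacian E) (mat 1) *v v + H_d H *v v"
  by (simp add: F_d_def matrix_vector_mult_add_rdistrib)

lemma transpose_F_d: "sym E \<Longrightarrow> transpose (F_d E H) = F_d E H"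
proof -
  assume "sym E"
  then have "transpose (kron (laplacian E) (mat 1)) = kron (laplacian E) (mat 1)"
    by (intro transpose_kron_mat_1 transpose_laplacian)
  moreover have "transpose (H_d H) = H_d H"
    by (simp add: H_d_def block_diag_def outer_def transpose_def vec_eq_iff mult.commute)
  ultimately show ?thesis
    unfolding F_d_def by (simp add: transpose_def vec_eq_iff)
qed

text \<open>Both parts of the form are nonnegative. If their sum vanishes, the Laplacian part makes
  all blocks equal to one vector \<open>y\<close>, the other part gives \<open>H *v y = 0\<close>,
  and full column rank gives \<open>y = 0\<close>.\<close>

lemma F_d_positive_definite:
  fixes H :: "real^'m^'n"
  assumes E: "sym E" and conn: "\<And>i j. (i, j) \<in> E\<^sup>*" and rank: "rank H = CARD('m)"
    and v: "v \<noteq> 0"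
  shows "0 < v \<bullet> (F_d E H *v v)"
proof -
  let ?block = "\<lambda>c. \<chi> j. v $ (j, c)"
  have L: "0 \<le> ?block c \<bullet> (laplacian E *v ?block c)" for c
    by (rule inner_laplacian_nonneg[OF E])
  have split: "v \<bullet> (F_d E H *v v) = (\<Sum>c\<in>UNIV. ?block c \<bullet> (laplacian E *v ?block c))
      + (\<Sum>i\<in>UNIV. (H $ i \<bullet> (\<chi> d. v $ (i, d)))\<^sup>2)"
    by (simp only: F_d_mult_vec inner_add_right inner_kron_mat_1 inner_H_d)
  have "v \<bullet> (F_d E H *v v) \<noteq> 0"
  proof
    assume 0: "v \<bullet> (F_d E H *v v) = 0"
    have nn: "0 \<le> (\<Sum>c\<in>UNIV. ?block c \<bullet> (laplacian E *v ?block c))"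
      "0 \<le> (\<Sum>i\<in>UNIV. (H $ i \<bullet> (\<chi> d. v $ (i, d)))\<^sup>2)"
      using L by (auto intro!: sum_nonneg)
    with 0 split have "(\<Sum>c\<in>UNIV. ?block c \<bullet> (laplacian E *v ?block c)) = 0"
      and "(\<Sum>i\<in>UNIV. (H $ i \<bullet> (\<chi> d. v $ (i, d)))\<^sup>2) = 0" by linarith+
    then have "?block c \<bullet> (laplacian E *v ?block c) = 0"
      and Hv: "H $ i \<bullet> (\<chi> d. v $ (i, d)) = 0" for c i
      using L by (simp_all add: sum_nonneg_eq_0_iff)
    then have "?block c $ i = ?block c $ j" for c i j
      using laplacian_kernel[OF E conn] by blast
    then have const: "v $ (i, c) = v $ (j, c)" for c i j by simp
    define y where "y = (\<chi> d. v $ (undefined, d))"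
    have y: "(\<chi> d. v $ (i, d)) = y" for i
      using const by (auto simp: y_def vec_eq_iff)
    have "H *v y = 0"
      using Hv by (simp add: vec_eq_iff matrix_vector_mul_component y)
    then have "y = 0"
      using full_rank_injective[of H] rank matrix_left_invertible_injective[of H]
      by (metis injD matrix_vector_mult_0_right)
    then have "v = 0"
      using y by (auto simp: vec_eq_iff)
    with v show False ..
  qed
  moreover have "0 \<le> v \<bullet> (F_d E H *v v)"
    unfolding split using L by (intro add_nonneg_nonneg sum_nonneg) auto
  ultimately show ?thesis by simp
qed

lemma kron_laplacian_consensus: "kron (laplacian E) (mat 1) *v kron_vec 1 y = 0"
  by (auto simp: vec_eq_iff kron_mat_1_mult_vec laplacian_mult_vec kron_vec_def)

section \<open>Error dynamics of the algorithm\<close>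

text \<open>Encoder and decoder start at zero and add the same increments.\<close>

lemma algorithm_decoder_eq:
  assumes "quantized_algorithm E H z x0 h K s \<gamma> x b q xhat" and "i \<in> nbrs E j"
  shows "xhat k i j = b k j"
  using assms by (induction k) (auto simp: quantized_algorithm_def)

text \<open>Since the data vector is \<open>H *v y\<close>, the local gradient depends only on
  \<open>x k i - y\<close>. Writing \<open>b\<close> as \<open>x\<close> minus the quantization
  error splits the consensus term into the Laplacian part of \<open>F_d\<close> and the
  perturbation; \<open>y\<close> drops out of differences between nodes.\<close>

lemma algorithm_error_dynamics:
  assumes E: "sym E"
    and alg: "quantized_algorithm E H (H *v y) x0 h K s \<gamma> x b q xhat"
    and \<gamma>: "\<gamma> k = 1"
  shows "stack (x (Suc k)) - kron_vec 1 y = (stack (x k) - kron_vec 1 y)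
      - h *\<^sub>R (F_d E H *v (stack (x k) - kron_vec 1 y))
      + h *\<^sub>R (kron (laplacian E) (mat 1) *v (stack (x k) - stack (b k)))"
proof -
  have "(stack (x (Suc k)) - kron_vec 1 y) $ (i, c)
      = ((stack (x k) - kron_vec 1 y)
      - h *\<^sub>R (F_d E H *v (stack (x k) - kron_vec 1 y))
      + h *\<^sub>R (kron (laplacian E) (mat 1) *v (stack (x k) - stack (b k)))) $ (i, c)" for i c
  proof -
    \<comment> \<open>\<open>algorithm_decoder_eq\<close> wants \<open>i \<in> nbrs E j\<close>,
      whereas the sum ranges over \<open>j \<in> nbrs E i\<close>; symmetry of \<open>E\<close>
      exchanges the two.\<close>
    have xhat: "(\<Sum>j\<in>nbrs E i. xhat k i j - b k i) = (\<Sum>j\<in>nbrs E i. b k j - b k i)"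
      using E by (intro sum.cong refl)
        (auto simp: nbrs_def dest: symD intro!: algorithm_decoder_eq[OF alg])
    have block: "(\<chi> d. (stack (x k) - kron_vec 1 y) $ (i, d)) = x k i - y"
      by (simp add: vec_eq_iff stack_def kron_vec_def)
    have "x (Suc k) i = x k i + h *\<^sub>R ((\<Sum>j\<in>nbrs E i. b k j - b k i)
        - (outer (H $ i) *v x k i - (H *v y) $ i *\<^sub>R H $ i))"
      using alg \<gamma> xhat by (simp add: quantized_algorithm_def)
    moreover have "outer (H $ i) *v x k i - (H *v y) $ i *\<^sub>R H $ i
        = (H $ i \<bullet> (x k i - y)) *\<^sub>R H $ i"
      by (simp add: vec_eq_iff outer_def matrix_vector_mult_def inner_vec_def
          sum_subtractf right_diff_distrib left_diff_distrib sum_distrib_left sum_distrib_right mult_ac)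
    ultimately have "x (Suc k) i $ c = x k i $ c + h * ((\<Sum>j\<in>nbrs E i. b k j $ c - b k i $ c)
        - (H $ i \<bullet> (x k i - y)) * H $ i $ c)"
      by simp
    moreover have "(F_d E H *v (stack (x k) - kron_vec 1 y)) $ (i, c)
        = (\<Sum>j\<in>nbrs E i. x k i $ c - x k j $ c) + (H $ i \<bullet> (x k i - y)) * H $ i $ c"
      by (simp only: F_d_mult_vec vector_add_component kron_mat_1_mult_vec laplacian_mult_vec
          H_d_mult_vec block) (simp add: stack_def kron_vec_def)
    moreover have "(kron (laplacian E) (mat 1) *v (stack (x k) - stack (b k))) $ (i, c)
        = (\<Sum>j\<in>nbrs E i. x k i $ c - x k j $ c) + (\<Sum>j\<in>nbrs E i. b k j $ c - b k i $ c)"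
      by (simp only: kron_mat_1_mult_vec laplacian_mult_vec)
        (simp add: stack_def sum_subtractf sum.distrib algebra_simps)
    ultimately show ?thesis
      by (simp only: vector_add_component vector_minus_component vector_scaleR_component)
        (simp add: stack_def kron_vec_def algebra_simps)
  qed
  then show ?thesis by (simp add: vec_eq_iff)
qed

text \<open>Without saturation the new error is \<open>s k\<close> times the rounding error of the
  scaled input, which is at most \<open>1/2\<close>.\<close>

lemma algorithm_quantization_error:
  assumes alg: "quantized_algorithm E H z x0 h K s \<gamma> x b q xhat"
    and K: "1 \<le> K" and s: "0 < s k"
    and u: "infnorm (stack (x (Suc k)) - stack (b k)) \<le> s k * (of_int K + 1/2)"
  shows "infnorm (stack (x (Suc k)) - stack (b (Suc k))) \<le> s k / 2"
proof (rule infnorm_le_cart)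
  fix p
  define d where "d = (stack (x (Suc k)) - stack (b k)) $ p"
  have "\<bar>d\<bar> \<le> s k * (of_int K + 1/2)"
    unfolding d_def using component_le_infnorm_cart u by (rule order_trans)
  then have "\<bar>d / s k\<bar> \<le> of_int K + 1/2"
    using s by (simp add: abs_divide pos_divide_le_eq mult.commute)
  from quantizer_error[OF K this]
  have "s k * \<bar>d / s k - of_int (quantizer K (d / s k))\<bar> \<le> s k * (1/2)"
    using s by (intro mult_left_mono) auto
  then have "\<bar>s k * (d / s k - of_int (quantizer K (d / s k)))\<bar> \<le> s k / 2"
    using s by (simp add: abs_mult)
  also have "s k * (d / s k - of_int (quantizer K (d / s k))) = d - s k * of_int (quantizer K (d / s k))"
    using s by (simp add: algebra_simps)
  also have "\<dots> = (stack (x (Suc k)) - stack (b (Suc k))) $ p"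
    using alg by (simp add: quantized_algorithm_def d_def stack_def quantize_def)
  finally show "\<bar>(stack (x (Suc k)) - stack (b (Suc k))) $ p\<bar> \<le> s k / 2" .
qed

text \<open>The two bounds support each other: a bounded quantisation error \<open>e\<close> keeps \<open>w\<close> below
  \<open>s k * B\<close>, and this keeps the quantiser input \<open>u\<close> inside the range \<open>\<kappa>\<close> where it does not
  saturate. The constant \<open>B\<close> is the fixed point of \<open>B = (\<rho> / \<alpha>) B + h \<mu> \<surd>n / (2 \<alpha>\<^sup>2)\<close>.\<close>

lemma quantized_contraction:
  fixes w e u :: "nat \<Rightarrow> real^'k" and P F :: "real^'k^'k"
  assumes w: "\<And>k. w (Suc k) = w k - h *\<^sub>R (F *v w k) + h *\<^sub>R (P *v e k)"
    and u: "\<And>k. u k = e k + h *\<^sub>R (P *v e k) - h *\<^sub>R (F *v w k)"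
    and e: "\<And>k. infnorm (u k) \<le> s k * \<kappa> \<Longrightarrow> infnorm (e (Suc k)) \<le> s k / 2"
    and contr: "\<And>v. norm (v - h *\<^sub>R (F *v v)) \<le> \<rho> * norm v"
    and P: "\<And>v. norm (P *v v) \<le> \<mu> * norm v"
    and F: "\<And>v. norm (F *v v) \<le> \<Lambda> * norm v"
    and Pinf: "\<And>v. infnorm (v + h *\<^sub>R (P *v v)) \<le> D * infnorm v"
    and nonneg: "0 \<le> h" "0 \<le> \<rho>" "0 \<le> \<mu>" "0 \<le> \<Lambda>" "0 \<le> D"
    and \<alpha>: "\<rho> < \<alpha>" and s0: "0 < s 0" and s: "\<And>k. s k = s 0 * \<alpha> ^ k"
    and B: "B = h * \<mu> * sqrt (real CARD('k)) / (2 * \<alpha> * (\<alpha> - \<rho>))"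
    and \<kappa>: "D / (2 * \<alpha>) + h * \<Lambda> * B \<le> \<kappa>"
    and w1: "norm (w 1) \<le> s 1 * B" and u0: "infnorm (u 0) \<le> s 0 * \<kappa>"
  shows "norm (w (Suc k)) \<le> s (Suc k) * B \<and> infnorm (e (Suc k)) \<le> s k / 2"
proof (induction k)
  \<comment> \<open>The claim starts at time \<open>1\<close>, as no scale bounds
    \<open>e 0\<close>; the initial data enter only through \<open>w1\<close> and
    \<open>u0\<close>.\<close>
  case 0
  with w1 e[OF u0] show ?case by simp
next
  case (Suc k)
  then have IHw: "norm (w (Suc k)) \<le> s (Suc k) * B" and IHe: "infnorm (e (Suc k)) \<le> s k / 2"
    by auto
  have \<alpha>0: "0 < \<alpha>" using \<alpha> nonneg by simp
  have sk: "0 < s k" for k unfolding s[of k] using s0 \<alpha>0 by simp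
  have sS: "s (Suc k) = \<alpha> * s k" for k
    by (subst s, subst (2) s) simp
  \<comment> \<open>The fixed-point equation for \<open>B\<close>, multiplied by
    \<open>\<alpha> * \<alpha>\<close>.\<close>
  have fix_pt: "\<rho> * \<alpha> * B + h * \<mu> * sqrt (real CARD('k)) / 2 = \<alpha> * \<alpha> * B"
    unfolding B using \<alpha>0 \<alpha> by (simp add: divide_simps) (simp add: algebra_simps)
  \<comment> \<open>Passing from the maximum norm to the Euclidean norm produces the dimension
    factor in \<open>B\<close>.\<close>
  have "norm (e (Suc k)) \<le> sqrt (real CARD('k)) * (s k / 2)"
    using norm_le_sqrt_card_infnorm[of "e (Suc k)"] IHe
    by (meson mult_left_mono order_trans real_sqrt_ge_zero of_nat_0_le_iff)
  then have Pe: "h * norm (P *v e (Suc k)) \<le> h * (\<mu> * (sqrt (real CARD('k)) * (s k / 2)))"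
    using nonneg by (intro mult_left_mono order_trans[OF P]) auto
  have "norm (w (Suc (Suc k))) \<le> norm (w (Suc k) - h *\<^sub>R (F *v w (Suc k))) + norm (h *\<^sub>R (P *v e (Suc k)))"
    unfolding w[of "Suc k"] by (rule norm_triangle_ineq)
  also have "\<dots> \<le> \<rho> * (s (Suc k) * B) + h * (\<mu> * (sqrt (real CARD('k)) * (s k / 2)))"
    using contr[of "w (Suc k)"] mult_left_mono[OF IHw \<open>0 \<le> \<rho>\<close>] Pe nonneg by simp
  also have "\<dots> = s k * (\<rho> * \<alpha> * B + h * \<mu> * sqrt (real CARD('k)) / 2)"
    by (simp add: sS algebra_simps)
  also have "\<dots> = s (Suc (Suc k)) * B"
    unfolding fix_pt by (simp add: sS)
  finally have "norm (w (Suc (Suc k))) \<le> s (Suc (Suc k)) * B" .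
  moreover have "infnorm (e (Suc (Suc k))) \<le> s (Suc k) / 2"
  proof (rule e)
    have "infnorm (F *v w (Suc k)) \<le> \<Lambda> * (s (Suc k) * B)"
      using infnorm_le_norm[of "F *v w (Suc k)"] F[of "w (Suc k)"] mult_left_mono[OF IHw \<open>0 \<le> \<Lambda>\<close>]
      by linarith
    then have Fw: "h * infnorm (F *v w (Suc k)) \<le> h * (\<Lambda> * (s (Suc k) * B))"
      using nonneg by (intro mult_left_mono)
    have "infnorm (u (Suc k))
        \<le> infnorm (e (Suc k) + h *\<^sub>R (P *v e (Suc k))) + infnorm (- (h *\<^sub>R (F *v w (Suc k))))"
      unfolding u[of "Suc k"] diff_conv_add_uminus by (rule infnorm_triangle)
    also have "\<dots> \<le> D * (s k / 2) + h * (\<Lambda> * (s (Suc k) * B))"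
      using Pinf[of "e (Suc k)"] mult_left_mono[OF IHe \<open>0 \<le> D\<close>] Fw nonneg
      by (simp add: infnorm_neg infnorm_mul)
    \<comment> \<open>The error \<open>e (Suc k)\<close> is measured by the older scale
      \<open>s k = s (Suc k) / \<alpha>\<close>, hence the \<open>\<alpha>\<close> in the
      denominator.\<close>
    also have "\<dots> = s (Suc k) * (D / (2 * \<alpha>) + h * \<Lambda> * B)"
      using \<alpha>0 by (simp add: sS field_simps)
    also have "\<dots> \<le> s (Suc k) * \<kappa>"
      using \<kappa> sk by (intro mult_left_mono) (auto intro: less_imp_le)
    finally show "infnorm (u (Suc k)) \<le> s (Suc k) * \<kappa>" .
  qed
  ultimately show ?case ..
qed

section \<open>Contraction of the gradient step and nonemptiness of \<open>Xi\<close>\<close>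

text \<open>The form of \<open>I - h F\<close> lies between \<open>1 - h * lambda_max F\<close> and
  \<open>1 - h * lambda_min F\<close> times \<open>v \<bullet> v\<close>, and the step-size
  condition says exactly that the lower factor is at least the negative of the upper one.\<close>

lemma norm_gradient_step_le:
  fixes F :: "real^'k^'k"
  assumes F: "transpose F = F" and h: "0 < h" "h * (lambda_min F + lambda_max F) \<le> 2"
  shows "norm (v - h *\<^sub>R (F *v v)) \<le> (1 - h * lambda_min F) * norm v"
proof -
  define T where "T = mat 1 - h *\<^sub>R F"
  have T: "T *v v = v - h *\<^sub>R (F *v v)" for v
    by (simp add: T_def matrix_vector_mult_diff_rdistrib scaleR_matrix_vector_assoc[symmetric])
  have "transpose T = T"
    using F by (simp add: T_def transpose_def mat_def vec_eq_iff)
  moreover have "\<bar>v \<bullet> (T *v v)\<bar> \<le> (1 - h * lambda_min F) * (v \<bullet> v)" for v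
  proof -
    have "h * (lambda_min F * (v \<bullet> v)) \<le> h * (v \<bullet> (F *v v))"
      "h * (v \<bullet> (F *v v)) \<le> h * (lambda_max F * (v \<bullet> v))"
      using lambda_min_lower[OF F] lambda_max_upper[OF F] h by (auto intro: mult_left_mono)
    moreover have "h * (lambda_min F + lambda_max F) * (v \<bullet> v) \<le> 2 * (v \<bullet> v)"
      using h by (intro mult_right_mono) auto
    ultimately show ?thesis
      by (simp add: T inner_diff_right algebra_simps abs_le_iff)
  qed
  ultimately have "norm (T *v v) \<le> (1 - h * lambda_min F) * norm v"
    by (rule norm_symmetric_matrix_le)
  then show ?thesis by (simp add: T)
qed

lemma norm_psd_matrix_le:
  fixes F :: "real^'k^'k"
  assumes F: "transpose F = F" and psd: "\<And>v. 0 \<le> v \<bullet> (F *v v)"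
  shows "norm (F *v v) \<le> lambda_max F * norm v"
  using psd lambda_max_upper[OF F] by (intro norm_symmetric_matrix_le[OF F]) simp

lemma Xi_nonempty:
  assumes pos: "0 < lambda_min (F_d E H)" and le: "lambda_min (F_d E H) \<le> lambda_max (F_d E H)"
    and K: "1 \<le> K"
  shows "Xi E H K \<noteq> {}"
proof -
  define l where "l = lambda_min (F_d E H)"
  define \<Lambda> where "\<Lambda> = lambda_max (F_d E H)"
  define d where "d = real (max_degree E)"
  define c where "c = sqrt (real (CARD('b) * CARD('a))) * lambda_max (laplacian E) * \<Lambda>"
  have l: "0 < l" "0 < l + \<Lambda>" using pos le by (simp_all add: l_def \<Lambda>_def)
  \<comment> \<open>For \<open>h > 0\<close> this is \<open>M E H \<alpha> h\<close> with
    \<open>\<alpha> = 1 - h * l / 2\<close>: then \<open>\<alpha> - rho E H h = h * l / 2\<close>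
    cancels one factor \<open>h\<close>, so the second term tends to \<open>0\<close>.\<close>
  let ?g = "\<lambda>h. (1 + 2 * h * d) / (2 * (1 - h * l / 2)) + h * c / ((1 - h * l / 2) * l)"
  have "(?g \<longlongrightarrow> 1/2) (at_right 0)"
    using l by (auto intro!: tendsto_eq_intros)
  \<comment> \<open>The value \<open>3/2\<close> is \<open>K + 1/2\<close> for the smallest
    \<open>K\<close>, so it suits every \<open>K \<ge> 1\<close>.\<close>
  then have "eventually (\<lambda>h. ?g h < 3/2) (at_right 0)"
    by (rule order_tendstoD) simp
  moreover have "eventually (\<lambda>h. h \<in> {0<..<2 / (l + \<Lambda>)}) (at_right 0)"
    using l by (intro eventually_at_right_real) simp
  ultimately obtain h where h: "?g h < 3/2" "h \<in> {0<..<2 / (l + \<Lambda>)}"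
    by (metis (mono_tags, lifting) eventually_conj eventually_happens trivial_limit_at_right_real)
  define \<alpha> where "\<alpha> = 1 - h * l / 2"
  have "M E H \<alpha> h = (1 + 2 * h * d) / (2 * \<alpha>) + h\<^sup>2 * c / (2 * \<alpha> * (h * l / 2))"
    by (simp add: M_def rho_def d_def c_def \<Lambda>_def \<alpha>_def l_def mult_ac)
  also have "\<dots> = ?g h"
    unfolding \<alpha>_def[symmetric] using h(2) by (simp add: power2_eq_square)
  also have "\<dots> < 3/2" by (rule h(1))
  also have "3/2 \<le> of_int K + (1/2 :: real)" using K by simp
  finally have "(\<alpha>, h) \<in> Xi E H K"
    using h l by (simp add: Xi_def \<alpha>_def l_def[symmetric] \<Lambda>_def[symmetric])
  then show ?thesis by blast
qed

section \<open>Convergence and rate of the quantized algorithm\<close>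

theorem theorem2:
  fixes E :: "('n::finite \<times> 'n) set"
    and H :: "real^'m^'n"
    and z :: "real^'n"
    and ystar :: "real^'m"
    and x0 :: "'n \<Rightarrow> real^'m"
    and C_x C_w :: real
  assumes "CARD('n) \<ge> 2"
    and "sym E" and "irrefl E" and "\<And>i j. (i, j) \<in> E\<^sup>*"
    and "rank H = CARD('m)" and "z \<in> span (columns H)" and "z = H *v ystar"
    and "C_x > 0" and "C_w > 0"
    and "\<And>i. infnorm (x0 i) \<le> C_x"
    and "\<And>i. infnorm (x0 i - ystar) \<le> C_w"
  shows "(\<forall>K \<ge> 1. Xi E H K \<noteq> {}) \<and>
    (\<forall>K \<ge> 1. \<forall>\<alpha> h s \<gamma> x b q xhat.
       (\<alpha>, h) \<in> Xi E H K \<and>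
       (\<forall>k. \<gamma> k = 1) \<and> s 0 > 0 \<and> \<alpha> \<in> {0<..<1} \<and> (\<forall>k. s k = s 0 * \<alpha> ^ k) \<and>
       s 0 > max ((C_x + h * inf_matrix_norm (H_d H) * C_w) / (of_int K + 1/2))
                 (2 * (\<alpha> - rho E H h) * (rho E H h * C_w + h * C_x * lambda_max (laplacian E))
                    / (h * lambda_max (laplacian E))) \<and>
       quantized_algorithm E H z x0 h K s \<gamma> x b q xhat \<longrightarrow>
         (\<forall>i. (\<lambda>k. x k i) \<longlonglongrightarrow> ystar) \<and>
         limsup (\<lambda>k. ereal (norm (stack (x k) - kron_vec 1 ystar) / \<alpha> ^ k))
           \<le> ereal (h * s 0 * sqrt (real (CARD('m) * CARD('n))) * lambda_max (laplacian E)
                      / (2 * \<alpha> * (\<alpha> - rho E H h))))"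
proof (intro conjI allI impI)
  fix K :: int
  assume K: "K \<ge> 1"
  have F: "transpose (F_d E H) = F_d E H"
    by (rule transpose_F_d) fact
  have pd: "0 < v \<bullet> (F_d E H *v v)" if "v \<noteq> 0" for v
    using that assms by (intro F_d_positive_definite) auto
  show "Xi E H K \<noteq> {}"
    using lambda_min_pos[OF F pd] lambda_min_le_lambda_max[OF F] K by (rule Xi_nonempty)
next
  fix K :: int and \<alpha> h :: real and s \<gamma> :: "nat \<Rightarrow> real"
    and x b q :: "nat \<Rightarrow> 'n \<Rightarrow> real^'m" and xhat :: "nat \<Rightarrow> 'n \<Rightarrow> 'n \<Rightarrow> real^'m"
  define l where "l = lambda_min (F_d E H)"
  define \<Lambda> where "\<Lambda> = lambda_max (F_d E H)"
  define \<mu> where "\<mu> = lambda_max (laplacian E)"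
  define \<rho> where "\<rho> = rho E H h"
  define n where "n = real (CARD('m) * CARD('n))"
  define B where "B = h * \<mu> * sqrt n / (2 * \<alpha> * (\<alpha> - \<rho>))"
  assume K: "K \<ge> 1"
  assume asm: "(\<alpha>, h) \<in> Xi E H K \<and>
       (\<forall>k. \<gamma> k = 1) \<and> s 0 > 0 \<and> \<alpha> \<in> {0<..<1} \<and> (\<forall>k. s k = s 0 * \<alpha> ^ k) \<and>
       s 0 > max ((C_x + h * inf_matrix_norm (H_d H) * C_w) / (of_int K + 1/2))
                 (2 * (\<alpha> - rho E H h) * (rho E H h * C_w + h * C_x * lambda_max (laplacian E))
                    / (h * lambda_max (laplacian E))) \<and>
       quantized_algorithm E H z x0 h K s \<gamma> x b q xhat"
  then have Xi: "(\<alpha>, h) \<in> Xi E H K" and \<gamma>: "\<gamma> k = 1" and s: "s k = s 0 * \<alpha> ^ k"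
    and s0: "0 < s 0" and \<alpha>_mem: "\<alpha> \<in> {0<..<1}"
    and s0_max: "max ((C_x + h * inf_matrix_norm (H_d H) * C_w) / (of_int K + 1/2))
        (2 * (\<alpha> - rho E H h) * (rho E H h * C_w + h * C_x * lambda_max (laplacian E))
          / (h * lambda_max (laplacian E))) < s 0"
    and "quantized_algorithm E H z x0 h K s \<gamma> x b q xhat" for k
    by blast+
  from this(7) have alg: "quantized_algorithm E H (H *v ystar) x0 h K s \<gamma> x b q xhat"
    by (simp only: \<open>z = H *v ystar\<close>)
  from \<alpha>_mem have \<alpha>: "0 < \<alpha>" "\<alpha> < 1" by simp_all
  have M: "M E H \<alpha> h < of_int K + 1/2"
    using Xi by (simp add: Xi_def)
  have sp: "0 < s k" for k
    unfolding s[of k] using s0 \<alpha> by simp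
  have F: "transpose (F_d E H) = F_d E H"
    by (rule transpose_F_d) fact
  have pd: "0 < v \<bullet> (F_d E H *v v)" if "v \<noteq> 0" for v
    using that assms by (intro F_d_positive_definite) auto
  have psd: "0 \<le> v \<bullet> (F_d E H *v v)" for v
    using pd[of v] by (cases "v = 0") auto
  have \<mu>: "0 < \<mu>"
    unfolding \<mu>_def using assms by (intro lambda_max_laplacian_pos) auto
  have l: "0 < l" "l \<le> \<Lambda>"
    unfolding l_def \<Lambda>_def using lambda_min_pos[OF F pd] lambda_min_le_lambda_max[OF F] by auto
  have h: "0 < h" "h < 2 / (l + \<Lambda>)" and \<rho>\<alpha>: "\<rho> < \<alpha>"
    using Xi by (auto simp: Xi_def l_def \<Lambda>_def \<rho>_def rho_def)
  then have h2: "h * (l + \<Lambda>) < 2"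
    using l by (simp add: pos_less_divide_eq)
  moreover have "h * l \<le> h * \<Lambda>"
    using h l by simp
  \<comment> \<open>From \<open>2 * h * l \<le> h * (l + \<Lambda>) < 2\<close>.\<close>
  ultimately have \<rho>: "0 \<le> \<rho>"
    by (simp add: \<rho>_def rho_def l_def[symmetric] distrib_left)
  define w where "w k = stack (x k) - kron_vec 1 ystar" for k
  define e where "e k = stack (x k) - stack (b k)" for k
  define u where "u k = stack (x (Suc k)) - stack (b k)" for k
  define P :: "real^('n \<times> 'm)^('n \<times> 'm)" where "P = kron (laplacian E) (mat 1)"
  define D where "D = 1 + 2 * h * real (max_degree E)"
  have n: "n = real CARD('n \<times> 'm)" by (simp add: n_def)
  have w: "w (Suc k) = w k - h *\<^sub>R (F_d E H *v w k) + h *\<^sub>R (P *v e k)" for k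
    unfolding w_def e_def P_def using \<open>sym E\<close> alg \<gamma> by (rule algorithm_error_dynamics)
  have u: "u k = e k + h *\<^sub>R (P *v e k) - h *\<^sub>R (F_d E H *v w k)" for k
  proof -
    have "u k = w (Suc k) - w k + e k"
      by (simp add: u_def w_def e_def)
    then show ?thesis by (simp add: w)
  qed
  have contr: "norm (v - h *\<^sub>R (F_d E H *v v)) \<le> \<rho> * norm v" for v
    using norm_gradient_step_le[OF F h(1), of v] h2
    by (simp add: \<rho>_def rho_def l_def \<Lambda>_def)
  have P: "norm (P *v v) \<le> \<mu> * norm v" for v
    unfolding P_def \<mu>_def by (rule norm_kron_laplacian_le) fact
  have x0: "x 0 = x0" and b0: "b 0 = (\<lambda>_. 0)"
    using alg by (auto simp: quantized_algorithm_def)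
  have e0: "infnorm (e 0) \<le> C_x"
  proof (rule infnorm_le_cart)
    fix p :: "'n \<times> 'm"
    show "\<bar>e 0 $ p\<bar> \<le> C_x"
      using order_trans[OF component_le_infnorm_cart assms(10)]
      by (simp add: e_def x0 b0 stack_def)
  qed
  have w0: "infnorm (w 0) \<le> C_w"
  proof (rule infnorm_le_cart)
    fix p :: "'n \<times> 'm"
    show "\<bar>w 0 $ p\<bar> \<le> C_w"
      using order_trans[OF component_le_infnorm_cart assms(11), of "fst p" "snd p"]
      by (simp add: w_def x0 stack_def kron_vec_def)
  qed
  have u0: "infnorm (u 0) \<le> s 0 * (of_int K + 1/2)"
  proof -
    \<comment> \<open>As \<open>b 0 = 0\<close>, \<open>e 0\<close> is the stacked initial state,
      which differs from \<open>w 0\<close> by a consensus vector. So the Laplacian terms in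
      \<open>u 0\<close> cancel and only \<open>H_d\<close> remains, as in the first lower bound on
      \<open>s 0\<close>.\<close>
    have "P *v w 0 = P *v e 0"
      by (simp add: w_def e_def b0 P_def stack_def matrix_vector_mult_diff_distrib
          kron_laplacian_consensus vec_eq_iff[of "0"] flip: zero_vec_def)
    then have "u 0 = e 0 + - (h *\<^sub>R (H_d H *v w 0))"
      by (simp add: u F_d_mult_vec P_def scaleR_add_right)
    then have "infnorm (u 0) \<le> infnorm (e 0) + infnorm (- (h *\<^sub>R (H_d H *v w 0)))"
      by (simp only: infnorm_triangle)
    also have "\<dots> = infnorm (e 0) + h * infnorm (H_d H *v w 0)"
      using h by (simp add: infnorm_neg infnorm_mul)
    also have "\<dots> \<le> C_x + h * (inf_matrix_norm (H_d H) * C_w)"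
    proof (intro add_mono e0 mult_left_mono)
      have "0 \<le> inf_matrix_norm (H_d H)"
        by (rule inf_matrix_norm_nonneg)
      then show "infnorm (H_d H *v w 0) \<le> inf_matrix_norm (H_d H) * C_w"
        using infnorm_matrix_vector_le[of "H_d H" "w 0"] w0 mult_left_mono order_trans by blast
    qed (use h in simp)
    also have "\<dots> \<le> s 0 * (of_int K + 1/2)"
      using s0_max K by (simp add: pos_divide_less_eq mult.assoc)
    finally show ?thesis .
  qed
  have w1: "norm (w 1) \<le> s 1 * B"
  proof -
    have "norm (w 1) \<le> norm (w 0 - h *\<^sub>R (F_d E H *v w 0)) + norm (h *\<^sub>R (P *v e 0))"
      unfolding One_nat_def w[of 0] by (rule norm_triangle_ineq)
    also have "\<dots> \<le> \<rho> * norm (w 0) + h * (\<mu> * norm (e 0))"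
      unfolding norm_scaleR using contr[of "w 0"] P[of "e 0"] h by (intro add_mono mult_mono) auto
    also have "\<dots> \<le> \<rho> * (sqrt n * C_w) + h * (\<mu> * (sqrt n * C_x))"
      unfolding n using \<rho> h \<mu> w0 e0
      by (intro add_mono mult_left_mono order_trans[OF norm_le_sqrt_card_infnorm]) auto
    also have "\<dots> = sqrt n * (\<rho> * C_w + h * C_x * \<mu>)"
      by (simp add: algebra_simps)
    \<comment> \<open>This is the second lower bound on \<open>s 0\<close>, solved for the
      bracket.\<close>
    also have "\<dots> \<le> sqrt n * (s 0 * (h * \<mu>) / (2 * (\<alpha> - \<rho>)))"
    proof (rule mult_left_mono)
      have "2 * (\<alpha> - \<rho>) * (\<rho> * C_w + h * C_x * \<mu>) / (h * \<mu>) < s 0"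
        using s0_max by (simp add: \<rho>_def \<mu>_def)
      then have "2 * (\<alpha> - \<rho>) * (\<rho> * C_w + h * C_x * \<mu>) < s 0 * (h * \<mu>)"
        using h \<mu> by (simp add: pos_divide_less_eq)
      then show "\<rho> * C_w + h * C_x * \<mu> \<le> s 0 * (h * \<mu>) / (2 * (\<alpha> - \<rho>))"
        using \<rho>\<alpha> by (simp add: pos_le_divide_eq mult.commute)
    qed (simp add: n)
    \<comment> \<open>The factor \<open>\<alpha>\<close> of \<open>s 1 = s 0 * \<alpha>\<close>
      cancels the one in the denominator of \<open>B\<close>.\<close>
    also have "\<dots> = s 1 * B"
      unfolding s[of 1] B_def using \<alpha> by simp
    finally show ?thesis .
  qed
  have bound: "norm (w (Suc k)) \<le> s (Suc k) * B" for k
  proof (rule conjunct1[OF quantized_contraction[where w = w and s = s and k = k and B = B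
          and e = e and u = u and P = P
          and F = "F_d E H" and h = h and \<kappa> = "of_int K + 1/2" and \<rho> = \<rho> and \<mu> = \<mu>
          and \<Lambda> = \<Lambda> and D = D and \<alpha> = \<alpha>]])
    show "infnorm (u k) \<le> s k * (of_int K + 1/2) \<Longrightarrow> infnorm (e (Suc k)) \<le> s k / 2" for k
      unfolding u_def e_def by (rule algorithm_quantization_error[OF alg K sp])
    show "norm (F_d E H *v v) \<le> \<Lambda> * norm v" for v
      unfolding \<Lambda>_def by (rule norm_psd_matrix_le[OF F psd])
    show "infnorm (v + h *\<^sub>R (P *v v)) \<le> D * infnorm v" for v
      unfolding P_def D_def using h by (intro infnorm_kron_laplacian_le) simp
    \<comment> \<open>The hypothesis on \<open>\<kappa>\<close> thus becomes the bound on
      \<open>M\<close> in \<open>Xi\<close>.\<close>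
    have "D / (2 * \<alpha>) + h * \<Lambda> * B = M E H \<alpha> h"
      by (simp add: M_def D_def B_def \<mu>_def \<Lambda>_def \<rho>_def n_def power2_eq_square mult_ac)
    then show "D / (2 * \<alpha>) + h * \<Lambda> * B \<le> of_int K + 1/2"
      using M by simp
    show "B = h * \<mu> * sqrt (real CARD('n \<times> 'm)) / (2 * \<alpha> * (\<alpha> - \<rho>))"
      by (simp only: B_def n)
    show "0 \<le> D" using h by (simp add: D_def)
  qed (rule w u contr P s s0 \<rho> \<rho>\<alpha> w1 u0 | use h \<mu> l in simp)+
  have geometric: "norm (w (Suc k)) \<le> s 0 * B * \<alpha> ^ Suc k" for k
    using bound[of k] unfolding s[of "Suc k"] by (simp only: mult_ac)
  have "(\<lambda>k. s 0 * B * \<alpha> ^ Suc k) \<longlonglongrightarrow> s 0 * B * 0"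
    using \<alpha> by (intro tendsto_mult_left[OF LIMSEQ_Suc[OF LIMSEQ_realpow_zero]]) auto
  then have "(\<lambda>k. s 0 * B * \<alpha> ^ Suc k) \<longlonglongrightarrow> 0"
    by (simp only: mult_zero_right)
  with always_eventually have "(\<lambda>k. w (Suc k)) \<longlonglongrightarrow> 0"
    by (rule Lim_null_comparison) (rule allI, rule geometric)
  then have lim: "w \<longlonglongrightarrow> 0" by (rule LIMSEQ_imp_Suc)
  show "(\<lambda>k. x k i) \<longlonglongrightarrow> ystar" for i
  proof (rule vec_tendstoI)
    fix c
    have "(\<lambda>k. w k $ (i, c) + ystar $ c) \<longlonglongrightarrow> 0 $ (i, c) + ystar $ c"
      by (intro tendsto_intros lim)
    then show "(\<lambda>k. x k i $ c) \<longlonglongrightarrow> ystar $ c"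
      by (simp add: w_def stack_def kron_vec_def)
  qed
  \<comment> \<open>The estimate starts at \<open>k = 1\<close>; the limit superior ignores time
    \<open>0\<close>.\<close>
  have "norm (w k) / \<alpha> ^ k \<le> s 0 * B" if "k \<ge> 1" for k
    using that geometric[of "k - 1"] \<alpha> by (simp add: pos_divide_le_eq del: power_Suc)
  then have "limsup (\<lambda>k. ereal (norm (w k) / \<alpha> ^ k)) \<le> ereal (s 0 * B)"
    by (intro Limsup_bounded eventually_sequentiallyI[of 1]) simp
  also have "s 0 * B = h * s 0 * sqrt (real (CARD('m) * CARD('n))) * lambda_max (laplacian E)
      / (2 * \<alpha> * (\<alpha> - rho E H h))"
    by (simp add: B_def \<mu>_def \<rho>_def n_def mult_ac)
  finally show "limsup (\<lambda>k. ereal (norm (stack (x k) - kron_vec 1 ystar) / \<alpha> ^ k))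
      \<le> ereal (h * s 0 * sqrt (real (CARD('m) * CARD('n))) * lambda_max (laplacian E)
          / (2 * \<alpha> * (\<alpha> - rho E H h)))"
    by (simp only: w_def)
qed

end
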